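(* Let $a$, $b$, $\ell$ be pairwise coprime non-zero integers, where $\ell=2^{\beta}d$ is a positive integer with $d$ an odd positive integer and $\beta\ge 0$. Let $\gamma\ge 0$ be an integer such that $2^{\gamma}\,\|\,a+b$. Then $\ell\in OG_{(a,b)}$ if and only if one of the following statements holds: 1. $\ell\in\{1,2\}$; 2. $d=1$ and $2\le\beta\le\gamma$; 3. $d\ge 3$, $0\le\beta\le\gamma$ and $2\,\|\,\mathrm{Ord}_p(ab^{-1})$ for every prime $p$ dividing $d$. Moreover, in case 3, $2\,\|\,\mathrm{Ord}_{\ell}(ab^{-1})$.
   Context: For coprime nonzero integers $a,b$, a positive integer $\ell$ is called oddly-good (with respect to $a$ and $b$) if there exists an odd integer $k\ge 1$ such that $\ell\mid a^k+b^k$; $OG_{(a,b)}$ denotes the set of all oddly-good integers with respect to $a$ and $b$. Here $b^{-1}$ denotes the multiplicative inverse of $b$ modulo $\ell$, and for a divisor $m$ of $\ell$, $\mathrm{Ord}_m(ab^{-1})$ denotes the multiplicative order of $ab^{-1}$ modulo $m$. The notation $2^{\gamma}\,\|\,n$ means that $\gamma$ is the largest integer such that $2^{\gamma}\mid n$ (in particular, the hypothesis $2^\gamma\,\|\,a+b$ entails $a+b\neq 0$). *)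

theory Defs
  imports "HOL-Number_Theory.Number_Theory" "HOL-Number_Theory.Modular_Inverse"
begin

definition oddly_good :: "int \<Rightarrow> int \<Rightarrow> int \<Rightarrow> bool" where
  "oddly_good a b l \<longleftrightarrow> l > 0 \<and> (\<exists>k::nat. k \<ge> 1 \<and> odd k \<and> l dvd a ^ k + b ^ k)"

definition OG :: "int \<Rightarrow> int \<Rightarrow> int set" where
  "OG a b = {l. oddly_good a b l}"

(* \<open>2\<^sup>g \<parallel> n\<close>. It never holds for n = 0, so it entails that n is nonzero. *)
definition two_pow_exactly_dvd :: "nat \<Rightarrow> int \<Rightarrow> bool" where
  "two_pow_exactly_dvd g n \<longleftrightarrow> 2 ^ g dvd n \<and> (\<forall>k::nat. 2 ^ k dvd n \<longrightarrow> k \<le> g)"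

(* Order modulo m, for a divisor m of l, of \<open>a b\<^sup>-\<^sup>1\<close>, where the inverse of b is taken modulo l.
   The first argument of both library functions is the modulus. *)
definition Ord_quot :: "int \<Rightarrow> int \<Rightarrow> int \<Rightarrow> int \<Rightarrow> nat" where
  "Ord_quot l m a b = ord m (a * modular_inverse l b)"

end

theory Submission
  imports Defs
begin

text \<open>
  The criterion has a uniform form: \<open>l = 2 ^ \<beta> * d\<close> divides \<open>a ^ k + b ^ k\<close> for some odd \<open>k\<close> if and
  only if \<open>\<beta> \<le> \<gamma>\<close> and \<open>2 \<parallel> Ord_p(a b\<^sup>-\<^sup>1)\<close> for every prime \<open>p\<close> dividing \<open>d\<close>. The three cases of the
  theorem only separate \<open>d = 1\<close>, where there are no primes to consider, from \<open>d \<ge> 3\<close>. For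
  \<open>l = 2\<close> the condition \<open>\<beta> \<le> \<gamma>\<close> is automatic, because \<open>a\<close> and \<open>b\<close> are then both odd.

  Put \<open>x = a b\<^sup>-\<^sup>1\<close>. For a divisor \<open>m\<close> of \<open>l\<close>, the relation \<open>m dvd a ^ k + b ^ k\<close> means
  \<open>x ^ k = -1\<close> modulo \<open>m\<close>, by \<open>dvd_powers_iff_cong_minus_one\<close>.

  Necessity: if \<open>x ^ k = -1\<close> modulo \<open>m > 2\<close> with \<open>k\<close> odd, then the order of \<open>x\<close> divides \<open>2 * k\<close>
  but not \<open>k\<close>, so it is twice an odd number. Taking \<open>m = p\<close> gives the condition at the primes, and
  taking \<open>m = l\<close> gives the final claim of the theorem. For the power of two, the cofactor of
  \<open>a + b\<close> in \<open>a ^ k + b ^ k\<close> is a sum of an odd number of odd terms, so an odd exponent \<open>k\<close> does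
  not change the exponent of \<open>2\<close>.

  Sufficiency: modulo a prime \<open>p\<close>, an element of order \<open>2 * h\<close> has \<open>h\<close>-th power \<open>-1\<close>, since a
  field has no other square roots of \<open>1\<close> than \<open>1\<close> and \<open>-1\<close>. The prime factors of \<open>d\<close>, and then
  \<open>2 ^ \<beta>\<close>, are put together by \<open>dvd_odd_powers_mult\<close>: the product of an oddly-good integer with
  an odd oddly-good integer is oddly-good. The two factors may share primes, so this also covers
  the passage from primes to prime powers.
\<close>

section \<open>Exact divisibility by powers of two\<close>

lemma two_pow_exactly_dvd_iff_le:
  assumes "two_pow_exactly_dvd g n"
  shows "2 ^ k dvd n \<longleftrightarrow> k \<le> g"
  using assms unfolding two_pow_exactly_dvd_def
  by (meson dvd_trans le_imp_power_dvd)

lemma two_pow_exactly_dvd_1_iff: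
  "two_pow_exactly_dvd 1 (int n) \<longleftrightarrow> (\<exists>h. odd h \<and> n = 2 * h)"
proof
  assume *: "two_pow_exactly_dvd 1 (int n)"
  have "(2::int) dvd int n" "\<not> (2::int)\<^sup>2 dvd int n"
    using two_pow_exactly_dvd_iff_le[OF *, of 1] two_pow_exactly_dvd_iff_le[OF *, of 2] by auto
  then show "\<exists>h. odd h \<and> n = 2 * h"
    by (simp add: power2_eq_square) presburger
next
  assume "\<exists>h. odd h \<and> n = 2 * h"
  then obtain h where h: "odd h" "n = 2 * h" by blast
  have "k \<le> 1" if k: "(2::int) ^ k dvd int n" for k
  proof (rule ccontr)
    assume "\<not> k \<le> 1"
    then have "(2::int) ^ 2 dvd 2 ^ k" by (intro le_imp_power_dvd) auto
    from this k have "(2::int) ^ 2 dvd int n" by (rule dvd_trans)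
    with h show False by (simp add: power2_eq_square) presburger
  qed
  with h show "two_pow_exactly_dvd 1 (int n)"
    by (simp add: two_pow_exactly_dvd_def)
qed

section \<open>Sums of two equal odd powers\<close>

lemma odd_power_add_factor:
  fixes u v :: "'a :: comm_ring_1"
  assumes "odd n"
  shows "u ^ n + v ^ n = (u + v) * (\<Sum>i<n. (- v) ^ (n - Suc i) * u ^ i)"
  using power_diff_sumr2[of u n "- v"] assms by simp

text \<open>
  After raising to the power \<open>j * k\<close>, both \<open>m\<close> and \<open>n\<close> divide the same sum \<open>u + v\<close>. Passing to the
  exponent \<open>n\<close> multiplies \<open>u + v\<close> by a cofactor with \<open>n\<close> terms. These terms are all congruent
  modulo \<open>n\<close>, because \<open>- v\<close> is congruent to \<open>u\<close>, so the cofactor supplies a further factor \<open>n\<close>.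
\<close>
lemma dvd_odd_powers_mult:
  fixes a b m n :: int
  assumes "m dvd a ^ j + b ^ j" and "n dvd a ^ k + b ^ k"
    and "odd j" and "odd k" and "odd n" and "n > 0"
  shows "m * n dvd a ^ (j * k * nat n) + b ^ (j * k * nat n)"
proof -
  define u v N where "u = a ^ (j * k)" and "v = b ^ (j * k)" and "N = nat n"
  have N: "odd N" "int N = n" using assms by (auto simp: N_def even_nat_iff)
  have "a ^ j + b ^ j dvd (a ^ j) ^ k + (b ^ j) ^ k"
    using odd_power_add_factor[OF \<open>odd k\<close>, of "a ^ j" "b ^ j"] by simp
  then have m: "m dvd u + v" using assms(1) by (auto simp: u_def v_def power_mult intro: dvd_trans)
  have "a ^ k + b ^ k dvd (a ^ k) ^ j + (b ^ k) ^ j"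
    using odd_power_add_factor[OF \<open>odd j\<close>, of "a ^ k" "b ^ k"] by simp
  then have n: "n dvd u + v" using assms(2)
    by (auto simp: u_def v_def mult.commute[of j k] power_mult intro: dvd_trans)
  have uv: "[- v = u] (mod n)" using n by (simp add: cong_iff_dvd_diff dvd_diff_commute)
  have "[(\<Sum>i<N. (- v) ^ (N - Suc i) * u ^ i) = (\<Sum>i<N. u ^ (N - Suc i) * u ^ i)] (mod n)"
    by (intro cong_sum cong_mult cong_pow uv cong_refl)
  also have "(\<Sum>i<N. u ^ (N - Suc i) * u ^ i) = (\<Sum>i<N. u ^ (N - 1))"
    by (intro sum.cong) (auto simp flip: power_add)
  also have "\<dots> = n * u ^ (N - 1)" using N by simp
  finally have "n dvd (\<Sum>i<N. (- v) ^ (N - Suc i) * u ^ i)"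
    using cong_dvd_iff by (metis dvd_triv_left)
  with m have "m * n dvd u ^ N + v ^ N"
    using odd_power_add_factor[OF N(1), of u v] by (simp add: mult_dvd_mono)
  then show ?thesis by (simp add: u_def v_def N_def power_mult)
qed

text \<open>
  The cofactor of \<open>a + b\<close> is odd, being a sum of \<open>k\<close> odd terms.
\<close>
lemma two_pow_dvd_odd_powers_iff:
  fixes a b :: int
  assumes "odd a" and "odd b" and "odd k"
  shows "2 ^ \<beta> dvd a ^ k + b ^ k \<longleftrightarrow> 2 ^ \<beta> dvd a + b"
proof -
  define S where "S = (\<Sum>i<k. (- b) ^ (k - Suc i) * a ^ i)"
  have "odd S" using assms by (simp add: S_def even_sum_iff)
  then have "coprime (2 ^ \<beta>) S" by simp
  moreover have "a ^ k + b ^ k = (a + b) * S"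
    unfolding S_def by (rule odd_power_add_factor[OF \<open>odd k\<close>])
  ultimately show ?thesis by (simp add: coprime_dvd_mult_left_iff)
qed

section \<open>The order of the quotient\<close>

text \<open>
  Divide \<open>a ^ k + b ^ k\<close> by the unit \<open>b ^ k\<close>. The inverse of \<open>b\<close> modulo \<open>l\<close> is also an inverse
  modulo every divisor \<open>m\<close> of \<open>l\<close>, so a single representative serves for all the moduli.
\<close>
lemma dvd_powers_iff_cong_minus_one:
  fixes a b l m :: int
  assumes "coprime b l" and "m dvd l"
  shows "m dvd a ^ k + b ^ k \<longleftrightarrow> [(a * modular_inverse l b) ^ k = - 1] (mod m)"
proof -
  define x where "x = a * modular_inverse l b"
  have "[b * modular_inverse l b = 1] (mod m)"
    using cong_modular_inverse1[OF assms(1)] assms(2) by (rule cong_dvd_modulus)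
  then have "[a * (b * modular_inverse l b) = a * 1] (mod m)" by (intro cong_mult cong_refl)
  then have "[b * x = a] (mod m)" by (simp add: x_def mult_ac)
  then have "[(b * x) ^ k = a ^ k] (mod m)" by (rule cong_pow)
  then have "[b ^ k * x ^ k + b ^ k = a ^ k + b ^ k] (mod m)"
    by (simp add: power_mult_distrib cong_add_rcancel)
  then have "m dvd a ^ k + b ^ k \<longleftrightarrow> m dvd b ^ k * (x ^ k + 1)"
    using cong_dvd_iff by (metis distrib_left mult.right_neutral)
  also have "coprime m (b ^ k)"
    using assms by (metis coprime_commute coprime_divisors coprime_power_right_iff dvd_refl)
  then have "m dvd b ^ k * (x ^ k + 1) \<longleftrightarrow> m dvd x ^ k + 1"
    by (simp add: coprime_dvd_mult_right_iff)
  finally show ?thesis by (simp add: cong_iff_dvd_diff x_def)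
qed

text \<open>
  The order depends only on the residue class, so the characterisation of its multiples for
  natural numbers carries over to integers: replace \<open>x\<close> by its nonnegative residue.
\<close>
lemma ord_divides_int:
  fixes m x :: int
  assumes "m > 0"
  shows "[x ^ k = 1] (mod m) \<longleftrightarrow> ord m x dvd k"
proof -
  define n y where "n = nat m" and "y = nat (x mod m)"
  have m: "m = int n" and y: "[x = int y] (mod m)"
    using assms by (simp_all add: n_def y_def)
  have pow: "[x ^ i = 1] (mod m) \<longleftrightarrow> [y ^ i = 1] (mod n)" for i
  proof -
    have "[x ^ i = int (y ^ i)] (mod m)" using cong_pow[OF y] by simp
    then have "[x ^ i = 1] (mod m) \<longleftrightarrow> [int (y ^ i) = int 1] (mod int n)"
      unfolding m of_nat_1 by (meson cong_sym cong_trans)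
    then show ?thesis by (simp only: cong_int_iff)
  qed
  have "coprime m x \<longleftrightarrow> coprime n y"
    using y unfolding m by (metis cong_imp_coprime cong_sym coprime_commute coprime_int_iff)
  then have "ord m x = ord n y" by (simp add: ord_def pow)
  then show ?thesis using pow by (simp only: ord_divides)
qed

text \<open>
  Squaring shows that the order divides \<open>2 * k\<close>. It does not divide \<open>k\<close>, because \<open>1\<close> and \<open>-1\<close> are
  distinct modulo \<open>m > 2\<close>. Hence the order is even, and half of it divides the odd number \<open>k\<close>.
\<close>
lemma two_exactly_dvd_ord_if_odd_power_minus_one:
  fixes m x :: int
  assumes "[x ^ k = - 1] (mod m)" and "odd k" and "m > 2"
  shows "two_pow_exactly_dvd 1 (int (ord m x))"
proof -
  have "[(x ^ k)\<^sup>2 = (- 1)\<^sup>2] (mod m)" using assms(1) by (rule cong_pow)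
  then have 1: "ord m x dvd 2 * k"
    using \<open>m > 2\<close> by (simp add: mult.commute flip: ord_divides_int power_mult)
  have 2: "\<not> ord m x dvd k"
  proof
    assume "ord m x dvd k"
    then have "[x ^ k = 1] (mod m)" using \<open>m > 2\<close> by (simp add: ord_divides_int)
    with assms(1) have "[- 1 = 1] (mod m)" by (meson cong_sym cong_trans)
    then have "m dvd 2" by (simp add: cong_iff_dvd_diff)
    with \<open>m > 2\<close> show False by (auto dest: zdvd_imp_le)
  qed
  have "even (ord m x)"
  proof (rule ccontr)
    assume "odd (ord m x)"
    then have "coprime (ord m x) 2" by simp
    with 1 2 show False by (simp add: coprime_dvd_mult_right_iff)
  qed
  then obtain h where h: "ord m x = 2 * h" by blast
  with 1 have "h dvd k" by simp
  with \<open>odd k\<close> have "odd h" by auto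
  with h show ?thesis using two_pow_exactly_dvd_1_iff by blast
qed

text \<open>
  The exponent is half the order: the corresponding power squares to \<open>1\<close> without being \<open>1\<close>, and
  modulo a prime this leaves only \<open>-1\<close>.
\<close>
lemma odd_power_minus_one_if_two_exactly_dvd_ord:
  fixes p x :: int
  assumes "prime p" and "two_pow_exactly_dvd 1 (int (ord p x))"
  shows "\<exists>h. odd h \<and> [x ^ h = - 1] (mod p)"
proof -
  obtain h where h: "odd h" "ord p x = 2 * h"
    using assms(2) two_pow_exactly_dvd_1_iff by blast
  then have "h > 0" by (auto intro: Nat.gr0I)
  have "[x ^ (2 * h) = 1] (mod p)" using h prime_gt_0_int[OF \<open>prime p\<close>] by (simp add: ord_divides_int)
  then have "p dvd (x ^ h - 1) * (x ^ h + 1)"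
    by (simp add: cong_iff_dvd_diff algebra_simps flip: power_add mult_2)
  moreover have "\<not> p dvd x ^ h - 1"
  proof
    assume "p dvd x ^ h - 1"
    then have "ord p x dvd h" 
      using prime_gt_0_int[OF \<open>prime p\<close>] by (simp add: cong_iff_dvd_diff flip: ord_divides_int)
    with h \<open>h > 0\<close> show False by (auto dest: dvd_imp_le)
  qed
  ultimately have "p dvd x ^ h + 1" using \<open>prime p\<close> by (auto simp: prime_dvd_mult_iff)
  with h show ?thesis by (auto simp: cong_iff_dvd_diff)
qed

section \<open>The criterion\<close>

lemma odd_dvd_odd_powers_if_primes:
  fixes a b n :: int
  assumes "odd n" and "n > 0"
    and "\<And>p. prime p \<Longrightarrow> p dvd n \<Longrightarrow> \<exists>k. odd k \<and> p dvd a ^ k + b ^ k"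
  shows "\<exists>k. odd k \<and> n dvd a ^ k + b ^ k"
  using assms
proof (induction n rule: prime_divisors_induct)
  case zero
  then show ?case by simp
next
  case (unit n)
  then show ?case by (metis odd_one unit_imp_dvd)
next
  case (factor p n)
  have "p > 0" using \<open>prime p\<close> by (rule prime_gt_0_int)
  with factor.prems have n: "odd p" "odd n" "n > 0" by (auto simp: zero_less_mult_iff)
  obtain j where j: "odd j" "p dvd a ^ j + b ^ j"
    using factor.prems(3)[OF \<open>prime p\<close>] by auto
  obtain k where k: "odd k" "n dvd a ^ k + b ^ k"
    using factor.IH n factor.prems(3) by (meson dvd_mult)
  show ?case
    using dvd_odd_powers_mult[OF j(2) k(2) j(1) k(1)] n j k
    by (metis even_mult_iff even_nat_iff less_imp_le)
qed

theorem corollary2: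
  fixes a b l d :: int and \<beta> \<gamma> :: nat
  assumes "a \<noteq> 0" and "b \<noteq> 0" and "l > 0"
    and "coprime a b" and "coprime a l" and "coprime b l"
    and "l = 2 ^ \<beta> * d" and "d > 0" and "odd d"
    and "two_pow_exactly_dvd \<gamma> (a + b)"
  shows "(l \<in> OG a b \<longleftrightarrow>
            l \<in> {1, 2} \<or>
            (d = 1 \<and> 2 \<le> \<beta> \<and> \<beta> \<le> \<gamma>) \<or>
            (d \<ge> 3 \<and> 0 \<le> \<beta> \<and> \<beta> \<le> \<gamma> \<and>
              (\<forall>p::int. prime p \<and> p dvd d \<longrightarrow> two_pow_exactly_dvd 1 (int (Ord_quot l p a b)))))
       \<and> ((d \<ge> 3 \<and> 0 \<le> \<beta> \<and> \<beta> \<le> \<gamma> \<and>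
            (\<forall>p::int. prime p \<and> p dvd d \<longrightarrow> two_pow_exactly_dvd 1 (int (Ord_quot l p a b))))
          \<longrightarrow> two_pow_exactly_dvd 1 (int (Ord_quot l l a b)))"
proof -
  have OG_iff: "l \<in> OG a b \<longleftrightarrow> (\<exists>k. odd k \<and> l dvd a ^ k + b ^ k)"
    using \<open>l > 0\<close> by (auto simp: OG_def oddly_good_def Suc_le_eq intro: odd_pos)
  have pow_iff: "2 ^ i dvd a + b \<longleftrightarrow> i \<le> \<gamma>" for i
    using two_pow_exactly_dvd_iff_le[OF assms(10)] .
  have d_le_l: "d \<le> l" using \<open>l = 2 ^ \<beta> * d\<close> \<open>l > 0\<close> by (intro zdvd_imp_le) auto
  have d_cases: "d = 1 \<or> d \<ge> 3" using \<open>d > 0\<close> \<open>odd d\<close> by presburger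
  have odd_ab: "odd a \<and> odd b" if "\<beta> \<ge> 1"
  proof -
    have "even l" using that \<open>l = 2 ^ \<beta> * d\<close> by simp
    with \<open>coprime a l\<close> \<open>coprime b l\<close> show ?thesis
      using coprime_common_divisor odd_one by blast
  qed
  let ?orders = "\<forall>p::int. prime p \<and> p dvd d \<longrightarrow> two_pow_exactly_dvd 1 (int (Ord_quot l p a b))"
  have ord_of_dvd: "two_pow_exactly_dvd 1 (int (Ord_quot l m a b))"
    if "odd k" "l dvd a ^ k + b ^ k" "m dvd l" "m > 2" for k m
  proof -
    have "m dvd a ^ k + b ^ k" using that(3,2) by (rule dvd_trans)
    then have "[(a * modular_inverse l b) ^ k = - 1] (mod m)"
      using dvd_powers_iff_cong_minus_one[OF \<open>coprime b l\<close> \<open>m dvd l\<close>] by blast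
    then show ?thesis
      unfolding Ord_quot_def using \<open>odd k\<close> \<open>m > 2\<close>
      by (rule two_exactly_dvd_ord_if_odd_power_minus_one)
  qed
  have necessary: "\<beta> \<le> \<gamma> \<and> ?orders" if k: "odd k" "l dvd a ^ k + b ^ k" for k
  proof (intro conjI allI impI)
    show "\<beta> \<le> \<gamma>"
    proof (cases "\<beta> \<ge> 1")
      case True
      have "2 ^ \<beta> dvd a ^ k + b ^ k" using k(2) \<open>l = 2 ^ \<beta> * d\<close> by (simp add: dvd_mult_left)
      then show ?thesis
        using two_pow_dvd_odd_powers_iff[of a b k \<beta>] odd_ab[OF True] k(1) pow_iff by blast
    qed simp
  next
    fix p :: int
    assume p: "prime p \<and> p dvd d"
    then have "p dvd l" using \<open>l = 2 ^ \<beta> * d\<close> by simp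
    moreover have "p > 2"
      using p \<open>odd d\<close> prime_ge_2_int[of p] by (cases "p = 2") auto
    ultimately show "two_pow_exactly_dvd 1 (int (Ord_quot l p a b))"
      by (rule ord_of_dvd[OF k])
  qed
  have sufficient: "\<exists>k. odd k \<and> l dvd a ^ k + b ^ k" if "\<beta> \<le> \<gamma>" "?orders"
  proof -
    have "\<exists>k. odd k \<and> d dvd a ^ k + b ^ k"
    proof (rule odd_dvd_odd_powers_if_primes[OF \<open>odd d\<close> \<open>d > 0\<close>])
      fix p :: int
      assume p: "prime p" "p dvd d"
      then have "p dvd l" using \<open>l = 2 ^ \<beta> * d\<close> by simp
      have "two_pow_exactly_dvd 1 (int (ord p (a * modular_inverse l b)))"
        using \<open>?orders\<close> p by (simp add: Ord_quot_def)
      from odd_power_minus_one_if_two_exactly_dvd_ord[OF p(1) this]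
      show "\<exists>k. odd k \<and> p dvd a ^ k + b ^ k"
        using dvd_powers_iff_cong_minus_one[OF \<open>coprime b l\<close> \<open>p dvd l\<close>] by blast
    qed
    then obtain k where k: "odd k" "d dvd a ^ k + b ^ k" by blast
    \<comment> \<open>The power of two already works with exponent \<open>1\<close>, so it can be the unrestricted factor.\<close>
    have "2 ^ \<beta> dvd a ^ 1 + b ^ 1" using \<open>\<beta> \<le> \<gamma>\<close> pow_iff by simp
    from dvd_odd_powers_mult[OF this k(2) odd_one k(1) \<open>odd d\<close> \<open>d > 0\<close>]
    have "l dvd a ^ (1 * k * nat d) + b ^ (1 * k * nat d)" using \<open>l = 2 ^ \<beta> * d\<close> by simp
    moreover have "odd (1 * k * nat d)" using k \<open>odd d\<close> \<open>d > 0\<close> by (simp add: even_nat_iff)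
    ultimately show ?thesis by blast
  qed
  have criterion: "l \<in> OG a b \<longleftrightarrow> \<beta> \<le> \<gamma> \<and> ?orders"
    unfolding OG_iff using necessary sufficient by blast
  have no_primes: "?orders" if "d = 1"
    using that by auto
  have small: "l \<in> {1, 2} \<longleftrightarrow> d = 1 \<and> \<beta> < 2"
  proof
    assume l: "l \<in> {1, 2}"
    then have "l \<le> 2" by auto
    with d_le_l have "d \<le> 2" by simp
    with d_cases have "d = 1" by simp
    moreover from this l have "(2::int) ^ \<beta> < 2 ^ 2" using \<open>l = 2 ^ \<beta> * d\<close> by auto
    then have "\<beta> < 2" by (rule power_less_imp_less_exp[rotated]) simp
    ultimately show "d = 1 \<and> \<beta> < 2" by simp
  next
    assume "d = 1 \<and> \<beta> < 2"
    then show "l \<in> {1, 2}" using \<open>l = 2 ^ \<beta> * d\<close> by (auto simp: less_2_cases_iff)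
  qed
  have beta_le_if_small: "\<beta> \<le> \<gamma>" if "\<beta> < 2"
  proof (cases "\<beta> \<ge> 1")
    case True
    with that odd_ab have "\<beta> = 1" "2 ^ 1 dvd a + b" by auto
    then show ?thesis using pow_iff by blast
  qed simp
  have "l \<in> OG a b \<longleftrightarrow> l \<in> {1, 2} \<or> (d = 1 \<and> 2 \<le> \<beta> \<and> \<beta> \<le> \<gamma>) \<or>
      (d \<ge> 3 \<and> 0 \<le> \<beta> \<and> \<beta> \<le> \<gamma> \<and> ?orders)"
    using d_cases
  proof
    assume "d = 1"
    then show ?thesis
      unfolding criterion small using no_primes beta_le_if_small by (cases "\<beta> < 2") auto
  next
    assume "d \<ge> 3"
    then show ?thesis unfolding criterion small by auto
  qed
  moreover have "two_pow_exactly_dvd 1 (int (Ord_quot l l a b))"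
    if case3: "d \<ge> 3 \<and> 0 \<le> \<beta> \<and> \<beta> \<le> \<gamma> \<and> ?orders"
  proof -
    obtain k where k: "odd k" "l dvd a ^ k + b ^ k" using case3 sufficient by blast
    have "l > 2" using d_le_l case3 by simp
    then show ?thesis by (rule ord_of_dvd[OF k dvd_refl])
  qed
  ultimately show ?thesis by blast
qed

end
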